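(* Let $(S,\mathcal{A},\mu)$ be a complete, $\sigma$-finite measure space, let $E$ be a Köthe function space over $(S,\mathcal{A},\mu)$, and let $X$ be a real Banach space. Then the following hold: (1) If $X$ is locally octahedral, then the Köthe-Bochner space $E(X)$ is locally octahedral. (2) If $X$ is locally almost square, then the Köthe-Bochner space $E(X)$ is locally almost square.
   Context: For a real Banach space $X$, $S_X=\{x\in X:\|x\|=1\}$ denotes its unit sphere. $X$ is called locally octahedral (LOH) if for every $x\in S_X$ and every $\varepsilon>0$ there exists $y\in S_X$ such that $\|x+y\|\geq 2-\varepsilon$ and $\|x-y\|\geq 2-\varepsilon$. $X$ is called locally almost square (LASQ) if for every $x\in S_X$ and every $\varepsilon>0$ there exists $y\in S_X$ such that $\|x+y\|\leq 1+\varepsilon$ and $\|x-y\|\leq 1+\varepsilon$. Let $(S,\mathcal{A},\mu)$ be a complete, $\sigma$-finite measure space. For $A\subseteq S$, $\chi_A$ denotes the characteristic function of $A$. A Köthe function space over $(S,\mathcal{A},\mu)$ is a Banach space $(E,\|\cdot\|_E)$ of real-valued measurable functions on $S$ (modulo equality $\mu$-almost everywhere) such that: (i) $\chi_A\in E$ for every $A\in\mathcal{A}$ with $\mu(A)<\infty$; (ii) if $f\in E$ and $A\in\mathcal{A}$ with $\mu(A)<\infty$, then $f$ is $\mu$-integrable over $A$; (iii) if $g$ is measurable and $f\in E$ are such that $|g(t)|\leq|f(t)|$ $\mu$-a.e., then $g\in E$ and $\|g\|_E\leq\|f\|_E$. A function $f:S\to X$ is called simple if there are finitely many pairwise disjoint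 sets $A_1,\dots,A_n\in\mathcal{A}$ with $\mu(A_i)<\infty$ for all $i$ such that $f$ is constant on each $A_i$ and $f(t)=0$ for every $t\in S\setminus\bigcup_{i=1}^n A_i$. A function $f:S\to X$ is Bochner-measurable if there is a sequence $(f_n)_{n\in\mathbb{N}}$ of simple functions with $\lim_{n\to\infty}\|f_n(t)-f(t)\|=0$ for $\mu$-a.e. $t\in S$. The Köthe-Bochner space $E(X)$ is the space of all Bochner-measurable functions $f:S\to X$ (modulo equality $\mu$-a.e.) such that the function $\|f(\cdot)\|:t\mapsto\|f(t)\|$ belongs to $E$, equipped with the norm $\|f\|_{E(X)}=\big\|\,\|f(\cdot)\|\,\big\|_E$; it is a Banach space. *)

theory Defs
  imports "HOL-Analysis.Analysis" "HOL-Library.Function_Algebras"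
begin

text \<open>
  Spaces of functions modulo equality almost everywhere are given by their representatives: a
  set \<open>V\<close> of functions, containing with a function all measurable functions a.e. equal to it,
  and a seminorm \<open>N\<close> on \<open>V\<close> that vanishes exactly on the functions that are a.e. zero, i.e. the
  pullback of the norm of the quotient. A class has norm 1 iff its representatives do, so the
  two definitions below, applied to \<open>(V, N)\<close>, speak about the unit sphere of the quotient.
  Addition and subtraction of functions are the pointwise ones of \<open>Function_Algebras\<close>. For a
  Banach space that is a type, take \<open>V = UNIV\<close> and \<open>N = norm\<close>.
\<close>

definition locally_octahedral :: "'b::ab_group_add set \<Rightarrow> ('b \<Rightarrow> real) \<Rightarrow> bool" where
  "locally_octahedral V N \<longleftrightarrow>
     (\<forall>x\<in>V. N x = 1 \<longrightarrow>
       (\<forall>\<epsilon>>0. \<exists>y\<in>V. N y = 1 \<and> N (x + y) \<ge> 2 - \<epsilon> \<and> N (x - y) \<ge> 2 - \<epsilon>))"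

definition locally_almost_square :: "'b::ab_group_add set \<Rightarrow> ('b \<Rightarrow> real) \<Rightarrow> bool" where
  "locally_almost_square V N \<longleftrightarrow>
     (\<forall>x\<in>V. N x = 1 \<longrightarrow>
       (\<forall>\<epsilon>>0. \<exists>y\<in>V. N y = 1 \<and> N (x + y) \<le> 1 + \<epsilon> \<and> N (x - y) \<le> 1 + \<epsilon>))"

text \<open>
  \<open>N\<close> is only meaningful on \<open>E\<close>. Values of functions outside \<open>space M\<close> are irrelevant: by
  \<open>solid\<close>, membership in \<open>E\<close> and the value of \<open>N\<close> do not depend on them.
\<close>

locale koethe_function_space =
  fixes M :: "'s measure" and E :: "('s \<Rightarrow> real) set" and N :: "('s \<Rightarrow> real) \<Rightarrow> real"
  assumes measurable: "E \<subseteq> borel_measurable M"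
    and zero: "(\<lambda>t. 0) \<in> E"
    and add: "f \<in> E \<Longrightarrow> g \<in> E \<Longrightarrow> (\<lambda>t. f t + g t) \<in> E"
    and scale: "f \<in> E \<Longrightarrow> (\<lambda>t. c * f t) \<in> E"
    and norm_nonneg: "f \<in> E \<Longrightarrow> 0 \<le> N f"
    and norm_eq_0_iff: "f \<in> E \<Longrightarrow> N f = 0 \<longleftrightarrow> (AE t in M. f t = 0)"
    and norm_triangle: "f \<in> E \<Longrightarrow> g \<in> E \<Longrightarrow> N (\<lambda>t. f t + g t) \<le> N f + N g"
    and norm_scale: "f \<in> E \<Longrightarrow> N (\<lambda>t. c * f t) = \<bar>c\<bar> * N f"
    and complete:
      "\<lbrakk>\<And>n. u n \<in> E;
        \<And>\<epsilon>. \<epsilon> > 0 \<Longrightarrow> \<exists>n0. \<forall>m\<ge>n0. \<forall>n\<ge>n0. N (\<lambda>t. u m t - u n t) < \<epsilon>\<rbrakk>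
       \<Longrightarrow> \<exists>f\<in>E. (\<lambda>n. N (\<lambda>t. u n t - f t)) \<longlonglongrightarrow> 0"
    and indicator: "A \<in> sets M \<Longrightarrow> emeasure M A < \<infinity> \<Longrightarrow> indicator A \<in> E"
    and integrable: "f \<in> E \<Longrightarrow> A \<in> sets M \<Longrightarrow> emeasure M A < \<infinity> \<Longrightarrow> set_integrable M A f"
    and solid:
      "f \<in> E \<Longrightarrow> g \<in> borel_measurable M \<Longrightarrow> (AE t in M. \<bar>g t\<bar> \<le> \<bar>f t\<bar>) \<Longrightarrow> g \<in> E \<and> N g \<le> N f"

definition bochner_simple :: "'s measure \<Rightarrow> ('s \<Rightarrow> 'a::zero) \<Rightarrow> bool" where
  "bochner_simple M f \<longleftrightarrow>
     (\<exists>(n::nat) A. disjoint_family_on A {..<n} \<and>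
        (\<forall>i<n. A i \<in> sets M \<and> emeasure M (A i) < \<infinity> \<and> (\<exists>c. \<forall>t\<in>A i. f t = c)) \<and>
        (\<forall>t\<in>space M - (\<Union>i<n. A i). f t = 0))"

definition bochner_measurable :: "'s measure \<Rightarrow> ('s \<Rightarrow> 'a::real_normed_vector) \<Rightarrow> bool" where
  "bochner_measurable M f \<longleftrightarrow>
     (\<exists>F. (\<forall>n::nat. bochner_simple M (F n)) \<and>
        (AE t in M. (\<lambda>n. norm (F n t - f t)) \<longlonglongrightarrow> 0))"

definition koethe_bochner ::
  "'s measure \<Rightarrow> ('s \<Rightarrow> real) set \<Rightarrow> ('s \<Rightarrow> 'a::real_normed_vector) set" where
  "koethe_bochner M E = {f. bochner_measurable M f \<and> (\<lambda>t. norm (f t)) \<in> E}"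

definition koethe_bochner_norm ::
  "(('s \<Rightarrow> real) \<Rightarrow> real) \<Rightarrow> ('s \<Rightarrow> 'a::real_normed_vector) \<Rightarrow> real" where
  "koethe_bochner_norm N f = N (\<lambda>t. norm (f t))"

end

theory Submission
  imports Defs
begin

text \<open>
  Both properties say that every unit vector \<open>x\<close> of \<open>X\<close> has a unit vector \<open>y\<close> for which the norms
  of \<open>x + y\<close> and \<open>x - y\<close> lie between given bounds \<open>a\<close> and \<open>b\<close>. Such a \<open>y\<close> is now chosen pointwise:
  given \<open>f\<close> in \<open>E(X)\<close>, one looks for \<open>g\<close> such that \<open>g t\<close> is \<open>norm (f t)\<close> times a vector that is good
  for the direction \<open>sgn (f t)\<close>. Then \<open>norm (g t) = norm (f t)\<close>, and the norms of \<open>f t + g t\<close> and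
  \<open>f t - g t\<close> lie between \<open>a * norm (f t)\<close> and \<open>b * norm (f t)\<close>, so the lattice property of \<open>E\<close> turns
  the pointwise bounds into bounds for the norm of \<open>E(X)\<close>. Both definitions allow an error, so it is
  enough to achieve this up to an arbitrarily small \<open>\<delta>\<close>.

  The difficulty is to keep \<open>g\<close> Bochner-measurable. If simple functions \<open>F n\<close> converge to \<open>f\<close>, then
  a vector that is good for \<open>sgn (F n t)\<close> is, up to an error \<open>\<delta>\<close>, also good for \<open>sgn (f t)\<close> as soon as
  the two directions are \<open>\<delta>\<close>-close. The first suitable index \<open>n\<close> depends measurably on \<open>t\<close>, and for
  fixed \<open>n\<close> only finitely many values of \<open>F n\<close> occur, so an arbitrary choice \<open>Y\<close> of good vectors
  does no harm: \<open>t \<mapsto> Y (F n t)\<close> is again simple. This is the lemma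
  \<open>bochner_measurable_direction_selection\<close>; the lemma \<open>koethe_bochner_direction_lift\<close> transfers
  its pointwise bounds to \<open>E(X)\<close>.
\<close>

section \<open>Bochner-measurable functions\<close>

text \<open>
  This description by a finite range with measurable fibres and a support of finite measure makes
  the closure properties of \<open>simple_function\<close> available.
\<close>

lemma bochner_simple_iff:
  fixes f :: "'s \<Rightarrow> 'a::real_vector"
  shows "bochner_simple M f \<longleftrightarrow> simple_function M f \<and> emeasure M {t\<in>space M. f t \<noteq> 0} < \<infinity>"
proof
  assume "bochner_simple M f"
  then obtain n :: nat and A where A: "disjoint_family_on A {..<n}"
    "\<And>i. i < n \<Longrightarrow> A i \<in> sets M \<and> emeasure M (A i) < \<infinity> \<and> (\<exists>c. \<forall>t\<in>A i. f t = c)"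
    and zero: "\<And>t. t \<in> space M - (\<Union>i<n. A i) \<Longrightarrow> f t = 0"
    unfolding bochner_simple_def by blast
  then obtain c where c: "\<And>i t. i < n \<Longrightarrow> t \<in> A i \<Longrightarrow> f t = c i"
    by metis
  have sub: "A i \<subseteq> space M" if "i < n" for i
    using A(2)[OF that] by (simp add: sets.sets_into_space)
  show "simple_function M f \<and> emeasure M {t\<in>space M. f t \<noteq> 0} < \<infinity>"
  proof
    show "simple_function M f"
      unfolding simple_function_def
    proof safe
      have "f ` space M \<subseteq> insert 0 (c ` {..<n})"
      proof
        fix x assume "x \<in> f ` space M"
        then obtain t where "t \<in> space M" "x = f t" by blast
        then show "x \<in> insert 0 (c ` {..<n})"
          using c zero[of t] by (cases "\<exists>i<n. t \<in> A i") auto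
      qed
      then show "finite (f ` space M)"
        by (rule finite_subset) simp
    next
      fix t
      let ?B = "(\<Union>i\<in>{i. i < n \<and> c i = f t}. A i) \<union>
        (if f t = 0 then space M - (\<Union>i<n. A i) else {})"
      have "f -` {f t} \<inter> space M = ?B"
      proof (intro set_eqI iffI)
        fix s assume s: "s \<in> f -` {f t} \<inter> space M"
        show "s \<in> ?B"
        proof (cases "\<exists>i<n. s \<in> A i")
          case True
          then show ?thesis using s c by force
        next
          case False
          then show ?thesis using s zero[of s] by auto
        qed
      next
        fix s assume "s \<in> ?B"
        then show "s \<in> f -` {f t} \<inter> space M"
          using c sub zero by (auto split: if_splits)
      qed
      moreover have "?B \<in> sets M"
        using A(2) by auto
      ultimately show "f -` {f t} \<inter> space M \<in> sets M" by simp
    qed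
    have "emeasure M {t\<in>space M. f t \<noteq> 0} \<le> emeasure M (\<Union>i<n. A i)"
    proof (rule emeasure_mono)
      show "{t\<in>space M. f t \<noteq> 0} \<subseteq> (\<Union>i<n. A i)"
        using zero by blast
    qed (use A(2) in auto)
    also have "\<dots> \<le> (\<Sum>i<n. emeasure M (A i))"
      using A(2) by (intro emeasure_subadditive_finite) auto
    also have "\<dots> < \<infinity>"
      using A(2) by (simp add: less_top)
    finally show "emeasure M {t\<in>space M. f t \<noteq> 0} < \<infinity>" .
  qed
next
  assume "simple_function M f \<and> emeasure M {t\<in>space M. f t \<noteq> 0} < \<infinity>"
  then have sf: "simple_function M f" and fin: "emeasure M {t\<in>space M. f t \<noteq> 0} < \<infinity>"
    by auto
  define R where "R = f ` space M - {0}"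
  have "finite R"
    using sf by (simp add: R_def simple_function_def)
  then obtain v where v: "bij_betw v {0..<card R} R"
    using ex_bij_betw_nat_finite by blast
  define A where "A i = f -` {v i} \<inter> space M" for i
  have vR: "v i \<in> R" if "i < card R" for i
    using v that by (auto simp: bij_betw_def)
  have meas: "A i \<in> sets M" if "i < card R" for i
    using sf vR[OF that] by (auto simp: A_def R_def simple_function_def)
  have supp: "{t\<in>space M. f t \<noteq> 0} \<in> sets M"
    using measurable_simple_function[OF sf] by measurable
  have "emeasure M (A i) \<le> emeasure M {t\<in>space M. f t \<noteq> 0}" if "i < card R" for i
    using vR[OF that] supp by (intro emeasure_mono) (auto simp: A_def R_def)
  then have "emeasure M (A i) < \<infinity>" if "i < card R" for i
    using that fin by (blast intro: le_less_trans)
  moreover have "disjoint_family_on A {..<card R}"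
    using v by (auto simp: disjoint_family_on_def A_def bij_betw_def inj_on_def)
  moreover have "f t = 0" if t: "t \<in> space M - (\<Union>i<card R. A i)" for t
  proof (rule ccontr)
    assume "f t \<noteq> 0"
    then have "f t \<in> v ` {0..<card R}"
      using v t by (auto simp: R_def bij_betw_def)
    then show False
      using t by (auto simp: A_def)
  qed
  moreover have "\<exists>c. \<forall>t\<in>A i. f t = c" for i
    by (auto simp: A_def)
  ultimately show "bochner_simple M f"
    using meas unfolding bochner_simple_def by (intro exI[of _ "card R"] exI[of _ A]) auto
qed

lemma bochner_simple_compose2:
  fixes f :: "'s \<Rightarrow> 'a::real_vector" and g :: "'s \<Rightarrow> 'b::real_vector"
    and p :: "'a \<Rightarrow> 'b \<Rightarrow> 'c::real_vector"
  assumes f: "bochner_simple M f" and g: "bochner_simple M g" and p0: "p 0 0 = 0"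
  shows "bochner_simple M (\<lambda>t. p (f t) (g t))"
proof -
  have [measurable]: "f \<in> measurable M (count_space UNIV)" "g \<in> measurable M (count_space UNIV)"
    using f g by (auto simp: bochner_simple_iff intro: measurable_simple_function)
  have "emeasure M {t\<in>space M. p (f t) (g t) \<noteq> 0} \<le>
      emeasure M ({t\<in>space M. f t \<noteq> 0} \<union> {t\<in>space M. g t \<noteq> 0})"
    by (intro emeasure_mono) (auto simp: p0)
  also have "\<dots> \<le> emeasure M {t\<in>space M. f t \<noteq> 0} + emeasure M {t\<in>space M. g t \<noteq> 0}"
    by (intro emeasure_subadditive) auto
  also have "\<dots> < \<infinity>"
    using f g by (simp add: bochner_simple_iff)
  finally show ?thesis
    using f g by (simp add: bochner_simple_iff simple_function_compose2)
qed

lemma bochner_measurable_iff: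
  fixes f :: "'s \<Rightarrow> 'a::real_normed_vector"
  shows "bochner_measurable M f \<longleftrightarrow>
    (\<exists>F. (\<forall>n. bochner_simple M (F n)) \<and> (AE t in M. (\<lambda>n. F n t) \<longlonglongrightarrow> f t))"
  unfolding bochner_measurable_def
  by (simp add: tendsto_norm_zero_iff LIM_zero_iff)

lemma bochner_measurable_compose2:
  fixes f :: "'s \<Rightarrow> 'a::real_normed_vector" and g :: "'s \<Rightarrow> 'b::real_normed_vector"
    and p :: "'a \<Rightarrow> 'b \<Rightarrow> 'c::real_normed_vector"
  assumes f: "bochner_measurable M f" and g: "bochner_measurable M g" and p0: "p 0 0 = 0"
    and p: "\<And>u v x y. u \<longlonglongrightarrow> x \<Longrightarrow> v \<longlonglongrightarrow> y \<Longrightarrow> (\<lambda>n. p (u n) (v n)) \<longlonglongrightarrow> p x y"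
  shows "bochner_measurable M (\<lambda>t. p (f t) (g t))"
proof -
  obtain F G where F: "\<And>n. bochner_simple M (F n)" "AE t in M. (\<lambda>n. F n t) \<longlonglongrightarrow> f t"
    and G: "\<And>n. bochner_simple M (G n)" "AE t in M. (\<lambda>n. G n t) \<longlonglongrightarrow> g t"
    using f g unfolding bochner_measurable_iff by blast
  have "bochner_simple M (\<lambda>t. p (F n t) (G n t))" for n
    using F(1) G(1) p0 by (rule bochner_simple_compose2)
  moreover have "AE t in M. (\<lambda>n. p (F n t) (G n t)) \<longlonglongrightarrow> p (f t) (g t)"
    using F(2) G(2) by eventually_elim (rule p)
  ultimately show ?thesis
    unfolding bochner_measurable_iff by (intro exI[of _ "\<lambda>n t. p (F n t) (G n t)"]) simp
qed

text \<open>
  Completeness of the measure enters here: \<open>norm \<circ> f\<close> is only almost everywhere a limit of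
  measurable functions, and the exceptional null set is arbitrary.
\<close>

lemma borel_measurable_norm_bochner_measurable:
  fixes f :: "'s \<Rightarrow> 'a::real_normed_vector"
  assumes "complete_measure M" and "bochner_measurable M f"
  shows "(\<lambda>t. norm (f t)) \<in> borel_measurable M"
proof -
  interpret complete_measure M by fact
  obtain F where F: "\<And>n. bochner_simple M (F n)" "AE t in M. (\<lambda>n. F n t) \<longlonglongrightarrow> f t"
    using assms(2) unfolding bochner_measurable_iff by blast
  have [measurable]: "(\<lambda>t. norm (F n t)) \<in> borel_measurable M" for n
    by (intro borel_measurable_simple_function simple_function_compose1[where g = norm])
      (use F(1)[of n] in \<open>simp add: bochner_simple_iff\<close>)
  define u where "u t = lim (\<lambda>n. norm (F n t))" for t
  have "u \<in> borel_measurable M"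
    unfolding u_def by measurable
  have ae: "AE t in M. u t = norm (f t)"
    using F(2) by eventually_elim (auto simp: u_def intro!: limI tendsto_norm)
  show ?thesis
  proof (rule measurableI)
    fix B :: "real set" assume B: "B \<in> sets borel"
    have "AE t in M. t \<in> u -` B \<inter> space M \<longleftrightarrow> t \<in> (\<lambda>t. norm (f t)) -` B \<inter> space M"
      using ae by eventually_elim auto
    moreover have "u -` B \<inter> space M \<in> sets M"
      using \<open>u \<in> borel_measurable M\<close> B by (rule measurable_sets)
    ultimately show "(\<lambda>t. norm (f t)) -` B \<inter> space M \<in> sets M"
      by (rule in_sets_AE) simp
  qed simp
qed

section \<open>Measurable selection of good directions\<close>

text \<open>
  The index used at \<open>t\<close> is the first \<open>n\<close> with \<open>F n t \<noteq> 0\<close> from which on the directions of the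
  approximating vectors stay \<open>\<delta>\<close>-close to that of \<open>F n t\<close>. Since this condition mentions only the
  simple functions \<open>F m\<close> and not their limit, it is measurable even when \<open>X\<close> is not separable and the
  Borel measurability of differences may fail.
\<close>

lemma bochner_measurable_direction_selection:
  fixes f :: "'s \<Rightarrow> 'a::real_normed_vector" and Y :: "'a \<Rightarrow> 'a"
  assumes "bochner_measurable M f" and \<delta>: "\<delta> > 0"
  obtains g where "bochner_measurable M g"
    and "AE t in M. (f t = 0 \<and> g t = 0) \<or>
      (\<exists>x. x \<noteq> 0 \<and> norm (sgn (f t) - sgn x) \<le> \<delta> \<and> g t = norm (f t) *\<^sub>R Y x)"
proof -
  obtain F where F: "\<And>n. bochner_simple M (F n)" "AE t in M. (\<lambda>n. F n t) \<longlonglongrightarrow> f t"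
    using assms(1) unfolding bochner_measurable_iff by blast
  have sf: "simple_function M (F n)" for n
    using F(1) by (simp add: bochner_simple_iff)
  define P where "P n t \<longleftrightarrow> F n t \<noteq> 0 \<and> (\<forall>m\<ge>n. norm (sgn (F m t) - sgn (F n t)) \<le> \<delta>)" for n t
  define \<nu> where "\<nu> t = (LEAST n. P n t)" for t
  define h where "h t = (if \<exists>n. P n t then Y (F (\<nu> t) t) else 0)" for t
  \<comment> \<open>The sum is \<open>h t\<close> if \<open>\<nu> t \<le> k\<close>, and 0 before; the factor \<open>norm (F k t)\<close> confines \<open>G k\<close> to a set of
    finite measure, whereas the support of \<open>h\<close> may have infinite measure.\<close>
  define G where "G k t = norm (F k t) *\<^sub>R (\<Sum>n\<le>k. if P n t \<and> \<nu> t = n then Y (F n t) else 0)" for k t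
  have [measurable]: "Measurable.pred M (P n)" for n
  proof -
    have "(\<lambda>t. norm (sgn (F m t) - sgn (F n t))) \<in> borel_measurable M" for m
      by (intro borel_measurable_simple_function
          simple_function_compose2[of M "F m" "F n" "\<lambda>x y. norm (sgn x - sgn y)"] sf)
    moreover have "F n \<in> measurable M (count_space UNIV)"
      by (rule measurable_simple_function[OF sf])
    ultimately show ?thesis
      unfolding P_def by measurable
  qed
  have [measurable]: "\<nu> \<in> measurable M (count_space UNIV)"
    unfolding \<nu>_def by measurable
  have simple: "bochner_simple M (G k)" for k
    unfolding bochner_simple_iff
  proof
    have "simple_function M (\<lambda>t. \<Sum>n\<le>k. if P n t \<and> \<nu> t = n then Y (F n t) else 0)"
    proof (rule simple_function_sum, rule simple_function_If)
      show "simple_function M (\<lambda>t. Y (F n t))" for n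
        by (rule simple_function_compose1[OF sf])
      show "{t \<in> space M. P n t \<and> \<nu> t = n} \<in> sets M" for n
        by measurable
    qed simp
    then show "simple_function M (G k)"
      unfolding G_def by (rule simple_function_compose2[OF sf])
    have "emeasure M {t \<in> space M. G k t \<noteq> 0} \<le> emeasure M {t \<in> space M. F k t \<noteq> 0}"
      using measurable_simple_function[OF sf, of k]
      by (intro emeasure_mono) (auto simp: G_def)
    also have "\<dots> < \<infinity>"
      using F(1)[of k] by (simp add: bochner_simple_iff)
    finally show "emeasure M {t \<in> space M. G k t \<noteq> 0} < \<infinity>" .
  qed
  have G_eq: "G k t = norm (F k t) *\<^sub>R h t" if "k \<ge> \<nu> t" for k t
  proof -
    have "(\<Sum>n\<le>k. if P n t \<and> \<nu> t = n then Y (F n t) else 0) =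
        (\<Sum>n\<le>k. if n = \<nu> t then (if P (\<nu> t) t then Y (F (\<nu> t) t) else 0) else 0)"
      by (intro sum.cong) auto
    also have "\<dots> = (if P (\<nu> t) t then Y (F (\<nu> t) t) else 0)"
      using that by (simp add: sum.delta)
    also have "\<dots> = h t"
      unfolding h_def \<nu>_def by (auto intro: LeastI_ex)
    finally show ?thesis by (simp add: G_def)
  qed
  have lim: "(\<lambda>k. G k t) \<longlonglongrightarrow> norm (f t) *\<^sub>R h t" if "(\<lambda>n. F n t) \<longlonglongrightarrow> f t" for t
  proof (rule Lim_transform_eventually)
    show "(\<lambda>k. norm (F k t) *\<^sub>R h t) \<longlonglongrightarrow> norm (f t) *\<^sub>R h t"
      using that by (intro tendsto_intros)
    show "\<forall>\<^sub>F k in sequentially. norm (F k t) *\<^sub>R h t = G k t"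
      using eventually_ge_at_top[of "\<nu> t"] by eventually_elim (simp add: G_eq)
  qed
  have good: "\<exists>x. x \<noteq> 0 \<and> norm (sgn (f t) - sgn x) \<le> \<delta> \<and> h t = Y x"
    if conv: "(\<lambda>n. F n t) \<longlonglongrightarrow> f t" and ft: "f t \<noteq> 0" for t
  proof -
    have sgn_conv: "(\<lambda>n. sgn (F n t)) \<longlonglongrightarrow> sgn (f t)"
      using conv ft by (rule tendsto_sgn)
    have "\<forall>\<^sub>F n in sequentially. dist (sgn (F n t)) (sgn (f t)) < \<delta> / 2 \<and> F n t \<noteq> 0"
      using tendstoD[OF sgn_conv, of "\<delta> / 2"] \<delta> tendsto_imp_eventually_ne[OF conv ft]
      by (auto intro: eventually_conj)
    then obtain n where n: "\<And>m. m \<ge> n \<Longrightarrow> dist (sgn (F m t)) (sgn (f t)) < \<delta> / 2 \<and> F m t \<noteq> 0"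
      unfolding eventually_sequentially by blast
    have "norm (sgn (F m t) - sgn (F n t)) \<le> \<delta>" if "m \<ge> n" for m
      using n[OF that] n[of n] dist_triangle2[of "sgn (F m t)" "sgn (F n t)" "sgn (f t)"]
      by (simp add: dist_norm)
    with n[of n] have "P n t" by (simp add: P_def)
    then have P: "P (\<nu> t) t" and h: "h t = Y (F (\<nu> t) t)"
      unfolding h_def \<nu>_def by (auto intro: LeastI)
    have "(\<lambda>m. norm (sgn (F m t) - sgn (F (\<nu> t) t))) \<longlonglongrightarrow> norm (sgn (f t) - sgn (F (\<nu> t) t))"
      by (intro tendsto_norm tendsto_diff sgn_conv tendsto_const)
    then have "norm (sgn (f t) - sgn (F (\<nu> t) t)) \<le> \<delta>"
      by (rule LIMSEQ_le_const2) (use P in \<open>auto simp: P_def\<close>)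
    with P h show ?thesis by (auto simp: P_def)
  qed
  show thesis
  proof
    show "bochner_measurable M (\<lambda>t. norm (f t) *\<^sub>R h t)"
      unfolding bochner_measurable_iff using simple F(2) lim
      by (intro exI[of _ G]) (auto elim: eventually_mono)
    show "AE t in M. (f t = 0 \<and> norm (f t) *\<^sub>R h t = 0) \<or>
      (\<exists>x. x \<noteq> 0 \<and> norm (sgn (f t) - sgn x) \<le> \<delta> \<and> norm (f t) *\<^sub>R h t = norm (f t) *\<^sub>R Y x)"
      using F(2)
    proof eventually_elim
      case (elim t)
      then show ?case
        using good[of t] by (cases "f t = 0") auto
    qed
  qed
qed

section \<open>Lifting to the Koethe-Bochner space\<close>

text \<open>
  Dividing by \<open>norm v\<close> turns the middle term into \<open>norm (sgn v + y)\<close>, and passing from \<open>sgn x\<close> to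
  \<open>sgn v\<close> costs at most \<open>\<delta>\<close>.
\<close>

lemma norm_add_scaled_direction_bounds:
  fixes v x y :: "'a::real_normed_vector"
  assumes "norm (sgn v - sgn x) \<le> \<delta>" and "a \<le> norm (sgn x + y)" and "norm (sgn x + y) \<le> b"
  shows "(a - \<delta>) * norm v \<le> norm (v + norm v *\<^sub>R y) \<and>
    norm (v + norm v *\<^sub>R y) \<le> (b + \<delta>) * norm v"
proof -
  have "v + norm v *\<^sub>R y = norm v *\<^sub>R (sgn v + y)"
    by (cases "v = 0") (simp_all add: sgn_div_norm scaleR_add_right)
  then have "norm (v + norm v *\<^sub>R y) = norm (sgn v + y) * norm v"
    by simp
  moreover have "\<bar>norm (sgn v + y) - norm (sgn x + y)\<bar> \<le> \<delta>"
    using norm_triangle_ineq3[of "sgn v + y" "sgn x + y"] assms(1) by simp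
  then have "a - \<delta> \<le> norm (sgn v + y)" "norm (sgn v + y) \<le> b + \<delta>"
    using assms(2,3) by auto
  ultimately show ?thesis
    by (auto intro!: mult_right_mono)
qed

text \<open>
  Solidity, applied once in each direction. The absolute value on \<open>b\<close> is the one from homogeneity of
  the norm; the lower bound has none because for negative \<open>a\<close> it holds by nonnegativity.
\<close>

lemma (in koethe_function_space) norm_bounds:
  assumes \<phi>: "\<phi> \<in> E" and \<psi>: "\<psi> \<in> borel_measurable M"
    and nonneg: "\<And>t. 0 \<le> \<phi> t" "\<And>t. 0 \<le> \<psi> t"
    and ae: "AE t in M. a * \<phi> t \<le> \<psi> t \<and> \<psi> t \<le> b * \<phi> t"
  shows "\<psi> \<in> E \<and> a * N \<phi> \<le> N \<psi> \<and> N \<psi> \<le> \<bar>b\<bar> * N \<phi>"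
proof -
  have "AE t in M. \<bar>\<psi> t\<bar> \<le> \<bar>b * \<phi> t\<bar>"
    using ae nonneg by (auto elim: eventually_mono)
  from solid[OF scale[OF \<phi>] \<psi> this] have \<psi>E: "\<psi> \<in> E" and upper: "N \<psi> \<le> \<bar>b\<bar> * N \<phi>"
    by (simp_all add: norm_scale[OF \<phi>])
  have "a * N \<phi> \<le> N \<psi>"
  proof (cases "a \<ge> 0")
    case True
    then have "AE t in M. \<bar>a * \<phi> t\<bar> \<le> \<bar>\<psi> t\<bar>"
      using ae nonneg by (auto elim: eventually_mono)
    moreover have "(\<lambda>t. a * \<phi> t) \<in> borel_measurable M"
      using scale[OF \<phi>] measurable by blast
    ultimately have "N (\<lambda>t. a * \<phi> t) \<le> N \<psi>"
      using solid[OF \<psi>E] by blast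
    then show ?thesis
      using True by (simp add: norm_scale[OF \<phi>])
  next
    case False
    then have "a * N \<phi> \<le> 0"
      using norm_nonneg[OF \<phi>] by (simp add: mult_nonpos_nonneg)
    then show ?thesis
      using norm_nonneg[OF \<psi>E] by linarith
  qed
  with \<psi>E upper show ?thesis by blast
qed

text \<open>
  The common core of the two statements. The loss of \<open>\<delta>\<close> comes from choosing the good vectors for
  approximations of the directions \<open>sgn (f t)\<close>.
\<close>

lemma (in koethe_function_space) koethe_bochner_direction_lift:
  fixes f :: "'s \<Rightarrow> 'a::real_normed_vector" and a b \<delta> :: real
  assumes "complete_measure M"
    and bounds: "\<And>x::'a. norm x = 1 \<Longrightarrow>
      \<exists>y. norm y = 1 \<and> (\<forall>z\<in>{x + y, x - y}. a \<le> norm z \<and> norm z \<le> b)"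
    and f: "f \<in> koethe_bochner M E" and \<delta>: "\<delta> > 0" and b: "b \<ge> 0"
  shows "\<exists>g\<in>koethe_bochner M E. koethe_bochner_norm N g = koethe_bochner_norm N f \<and>
    (\<forall>k\<in>{f + g, f - g}. (a - \<delta>) * koethe_bochner_norm N f \<le> koethe_bochner_norm N k \<and>
      koethe_bochner_norm N k \<le> (b + \<delta>) * koethe_bochner_norm N f)"
proof -
  have fm: "bochner_measurable M f" and fE: "(\<lambda>t. norm (f t)) \<in> E"
    using f by (auto simp: koethe_bochner_def)
  have "\<forall>x::'a. \<exists>y. x \<noteq> 0 \<longrightarrow> norm y = 1 \<and> (\<forall>z\<in>{sgn x + y, sgn x - y}. a \<le> norm z \<and> norm z \<le> b)"
    using bounds by (metis norm_sgn)
  then obtain Y where Y: "\<And>x::'a. x \<noteq> 0 \<Longrightarrow> norm (Y x) = 1 \<and>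
      (\<forall>z\<in>{sgn x + Y x, sgn x - Y x}. a \<le> norm z \<and> norm z \<le> b)"
    by metis
  obtain g where gm: "bochner_measurable M g" and g: "AE t in M. (f t = 0 \<and> g t = 0) \<or>
      (\<exists>x. x \<noteq> 0 \<and> norm (sgn (f t) - sgn x) \<le> \<delta> \<and> g t = norm (f t) *\<^sub>R Y x)"
    using bochner_measurable_direction_selection[OF fm \<delta>] .
  have pointwise: "AE t in M. norm (g t) = norm (f t) \<and>
    (a - \<delta>) * norm (f t) \<le> norm (f t + g t) \<and> norm (f t + g t) \<le> (b + \<delta>) * norm (f t) \<and>
    (a - \<delta>) * norm (f t) \<le> norm (f t - g t) \<and> norm (f t - g t) \<le> (b + \<delta>) * norm (f t)"
    using g
  proof eventually_elim
    case (elim t)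
    then show ?case
    proof
      assume "\<exists>x. x \<noteq> 0 \<and> norm (sgn (f t) - sgn x) \<le> \<delta> \<and> g t = norm (f t) *\<^sub>R Y x"
      then obtain x where x: "x \<noteq> 0" "norm (sgn (f t) - sgn x) \<le> \<delta>" "g t = norm (f t) *\<^sub>R Y x"
        by blast
      show ?thesis
        using Y[OF x(1)] norm_add_scaled_direction_bounds[OF x(2), of a "Y x" b]
          norm_add_scaled_direction_bounds[OF x(2), of a "- Y x" b]
        by (simp add: x(3))
    qed simp
  qed
  have gE: "(\<lambda>t. norm (g t)) \<in> E \<and> 1 * N (\<lambda>t. norm (f t)) \<le> N (\<lambda>t. norm (g t)) \<and>
      N (\<lambda>t. norm (g t)) \<le> \<bar>1\<bar> * N (\<lambda>t. norm (f t))"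
    using pointwise
    by (intro norm_bounds fE borel_measurable_norm_bochner_measurable assms(1) gm)
      (auto elim: eventually_mono)
  have plus: "bochner_measurable M (\<lambda>t. f t + g t)"
    by (rule bochner_measurable_compose2[OF fm gm]) (auto intro: tendsto_add)
  have minus: "bochner_measurable M (\<lambda>t. f t - g t)"
    by (rule bochner_measurable_compose2[OF fm gm]) (auto intro: tendsto_diff)
  have "(a - \<delta>) * N (\<lambda>t. norm (f t)) \<le> N (\<lambda>t. norm (k t)) \<and>
      N (\<lambda>t. norm (k t)) \<le> \<bar>b + \<delta>\<bar> * N (\<lambda>t. norm (f t))" if "k \<in> {f + g, f - g}" for k
  proof -
    have "bochner_measurable M k"
      using that plus minus by (auto simp: plus_fun_def fun_diff_def)
    moreover have "AE t in M. (a - \<delta>) * norm (f t) \<le> norm (k t) \<and> norm (k t) \<le> (b + \<delta>) * norm (f t)"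
      using pointwise by eventually_elim (use that in auto)
    ultimately have "(\<lambda>t. norm (k t)) \<in> E \<and> (a - \<delta>) * N (\<lambda>t. norm (f t)) \<le> N (\<lambda>t. norm (k t)) \<and>
      N (\<lambda>t. norm (k t)) \<le> \<bar>b + \<delta>\<bar> * N (\<lambda>t. norm (f t))"
      by (intro norm_bounds fE borel_measurable_norm_bochner_measurable assms(1)) auto
    then show ?thesis by blast
  qed
  then show ?thesis
    using gE gm b \<delta> by (intro bexI[of _ g]) (auto simp: koethe_bochner_def koethe_bochner_norm_def)
qed

theorem theorem3p1:
  fixes M :: "'s measure" and E :: "('s \<Rightarrow> real) set" and N :: "('s \<Rightarrow> real) \<Rightarrow> real"
  assumes "complete_measure M" and "sigma_finite_measure M"
    and "koethe_function_space M E N"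
  shows "(locally_octahedral (UNIV :: 'a::banach set) norm \<longrightarrow>
            locally_octahedral (koethe_bochner M E :: ('s \<Rightarrow> 'a) set) (koethe_bochner_norm N)) \<and>
         (locally_almost_square (UNIV :: 'a set) norm \<longrightarrow>
            locally_almost_square (koethe_bochner M E :: ('s \<Rightarrow> 'a) set) (koethe_bochner_norm N))"
proof (intro conjI impI)
  interpret koethe_function_space M E N by fact
  let ?N = "koethe_bochner_norm N"
  {
    assume X: "locally_octahedral (UNIV :: 'a set) norm"
    show "locally_octahedral (koethe_bochner M E :: ('s \<Rightarrow> 'a) set) ?N"
      unfolding locally_octahedral_def
    proof (intro ballI impI allI)
      fix f :: "'s \<Rightarrow> 'a" and \<epsilon> :: real
      assume f: "f \<in> koethe_bochner M E" "?N f = 1" and \<epsilon>: "\<epsilon> > 0"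
      \<comment> \<open>The upper bound 2 is the triangle inequality.\<close>
      have "\<exists>y. norm y = 1 \<and> (\<forall>z\<in>{x + y, x - y}. 2 - \<epsilon> / 2 \<le> norm z \<and> norm z \<le> 2)"
        if x: "norm x = 1" for x :: 'a
      proof -
        obtain y where "norm y = 1" "2 - \<epsilon> / 2 \<le> norm (x + y)" "2 - \<epsilon> / 2 \<le> norm (x - y)"
          using X x \<epsilon> unfolding locally_octahedral_def by (metis UNIV_I half_gt_zero)
        then show ?thesis
          using x norm_triangle_ineq[of x y] norm_triangle_ineq4[of x y]
          by (intro exI[of _ y]) auto
      qed
      from koethe_bochner_direction_lift[OF assms(1) this f(1), of "\<epsilon> / 2"] \<epsilon> f(2)
      show "\<exists>g\<in>koethe_bochner M E. ?N g = 1 \<and> 2 - \<epsilon> \<le> ?N (f + g) \<and> 2 - \<epsilon> \<le> ?N (f - g)"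
        by auto
    qed
  next
    assume X: "locally_almost_square (UNIV :: 'a set) norm"
    show "locally_almost_square (koethe_bochner M E :: ('s \<Rightarrow> 'a) set) ?N"
      unfolding locally_almost_square_def
    proof (intro ballI impI allI)
      fix f :: "'s \<Rightarrow> 'a" and \<epsilon> :: real
      assume f: "f \<in> koethe_bochner M E" "?N f = 1" and \<epsilon>: "\<epsilon> > 0"
      have "\<exists>y. norm y = 1 \<and> (\<forall>z\<in>{x + y, x - y}. 0 \<le> norm z \<and> norm z \<le> 1 + \<epsilon> / 2)"
        if x: "norm x = 1" for x :: 'a
      proof -
        obtain y where "norm y = 1" "norm (x + y) \<le> 1 + \<epsilon> / 2" "norm (x - y) \<le> 1 + \<epsilon> / 2"
          using X x \<epsilon> unfolding locally_almost_square_def by (metis UNIV_I half_gt_zero)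
        then show ?thesis
          by (intro exI[of _ y]) auto
      qed
      from koethe_bochner_direction_lift[OF assms(1) this f(1), of "\<epsilon> / 2"] \<epsilon> f(2)
      show "\<exists>g\<in>koethe_bochner M E. ?N g = 1 \<and> ?N (f + g) \<le> 1 + \<epsilon> \<and> ?N (f - g) \<le> 1 + \<epsilon>"
        by auto
    qed
  }
qed

end
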